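(* Let $M$ be a connected matroid of rank $r>0$ on a finite set $E$ with $|E|=2r+1$, such that $\operatorname{crowd}(S)\le0$ for every proper subset $S\subsetneq E$. Let $T_1,\dots,T_p$ be the (distinct) inclusion-minimal nonempty crowded subsets of $E$, and suppose that $T_i\cup T_j=E$ for all $i\ne j$. Then the crowding records of crowding $0$ are exactly $\emptyset$ and $T_1,\dots,T_p$. Moreover, $p$ is odd, and $\omega(M)=\tfrac{p-1}{2}$.
   Context: **Crowding.** For $S\subseteq E$, the crowding of $S$ is $\operatorname{crowd}(S)=|S|-2\operatorname{rank}_M(S)$; $S$ is crowded if $\operatorname{crowd}(S)\ge0$. For $T\subseteq S\subseteq E$, $T$ is a summand of $S$ if $\operatorname{rank}_M(S)=\operatorname{rank}_M(T)+\operatorname{rank}_M(S\setminus T)$. $T$ is overcrowded in $S$ if either $\operatorname{crowd}(T)>\operatorname{crowd}(S)$, or $\operatorname{crowd}(T)=\operatorname{crowd}(S)$ and $T$ is not a summand of $S$. $S$ is a crowding record if no subset of $S$ is overcrowded in $S$. **$g$ and $\omega$.** Let $n=|E|$ and let $c(M)$ be the number of connected components of $M$. Speyer's $g$-polynomial $g_M(t)\in\mathbb Z[t]$ is given as follows (in the form of Berget–Eur–Spink–Tseng, equivalent to the original $K$-theoretic definition). If $E=\emptyset$, $g_M=1$. If $M$ has a loop or a coloop, $g_M=0$. Otherwise, for each total ordering $w=(w_1,\dots,w_n)$ of $E$, let $B_w$ be the basis with $w_k\in B_w$ iff $\operatorname{rank}\{w_1,\dots,w_k\}>\operatorname{rank}\{w_1,\dots,w_{k-1}\}$.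 In $\mathbb Z[z_e:e\in E]$, let $x^w$ be the list of the $z_b$, $b\in B_w$; let $y^w$ be the list of the $-z_c$, $c\in E\setminus B_w$; let $\alpha^w=-z_{w_n}$. For a family $f=(f_w)_w$ put $\deg f=\sum_w f_w/\prod_{i=1}^{n-1}(z_{w_i}-z_{w_{i+1}})$. With $\boldsymbol e_k$ the $k$-th elementary symmetric polynomial, $$g_M(t)=(-1)^{c(M)}\sum_{i=1}^{r}(-t)^i\sum_{j=0}^{i-1}\deg\big(\alpha^j\,\boldsymbol e_{i-j-1}(-y)\,\boldsymbol e_{r-i}(x)\,\boldsymbol e_{n-r}(y)\big).$$ $\omega(M)$ is the coefficient of $t^r$ in $g_M(t)$. *)

theory Defs
  imports
    "HOL-Library.Poly_Mapping"
    "HOL-Computational_Algebra.Polynomial"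
    "HOL-Computational_Algebra.Fraction_Field"
    "HOL-Combinatorics.Multiset_Permutations"
begin

section \<open>Matroids\<close>

locale matroid =
  fixes E :: "'a set" and indep :: "'a set \<Rightarrow> bool"
  assumes finite_ground: "finite E"
    and indep_subset_ground: "indep X \<Longrightarrow> X \<subseteq> E"
    and indep_empty: "indep {}"
    and indep_mono: "indep Y \<Longrightarrow> X \<subseteq> Y \<Longrightarrow> indep X"
    and augment: "indep X \<Longrightarrow> indep Y \<Longrightarrow> card X < card Y \<Longrightarrow>
      \<exists>y\<in>Y - X. indep (insert y X)"

definition mrank :: "('a set \<Rightarrow> bool) \<Rightarrow> 'a set \<Rightarrow> nat" where
  "mrank indep S = Max (card ` {X. X \<subseteq> S \<and> indep X})"

definition basis :: "('a set \<Rightarrow> bool) \<Rightarrow> 'a set \<Rightarrow> bool" where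
  "basis indep B \<longleftrightarrow> indep B \<and> (\<forall>X. indep X \<and> B \<subseteq> X \<longrightarrow> X = B)"

definition circuit :: "'a set \<Rightarrow> ('a set \<Rightarrow> bool) \<Rightarrow> 'a set \<Rightarrow> bool" where
  "circuit E indep C \<longleftrightarrow> C \<subseteq> E \<and> \<not> indep C \<and> (\<forall>X. X \<subset> C \<longrightarrow> indep X)"

definition loop :: "'a set \<Rightarrow> ('a set \<Rightarrow> bool) \<Rightarrow> 'a \<Rightarrow> bool" where
  "loop E indep e \<longleftrightarrow> e \<in> E \<and> \<not> indep {e}"

definition coloop :: "'a set \<Rightarrow> ('a set \<Rightarrow> bool) \<Rightarrow> 'a \<Rightarrow> bool" where
  "coloop E indep e \<longleftrightarrow> e \<in> E \<and> (\<forall>B. basis indep B \<longrightarrow> e \<in> B)"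

text \<open>
  On the ground set of a matroid this is an equivalence relation, and the connected components
  are its classes.
\<close>
definition conn_rel :: "'a set \<Rightarrow> ('a set \<Rightarrow> bool) \<Rightarrow> ('a \<times> 'a) set" where
  "conn_rel E indep =
     {(e, f) \<in> E \<times> E. e = f \<or> (\<exists>C. circuit E indep C \<and> e \<in> C \<and> f \<in> C)}"

definition num_components :: "'a set \<Rightarrow> ('a set \<Rightarrow> bool) \<Rightarrow> nat" where
  "num_components E indep = card (E // conn_rel E indep)"

definition connected_matroid :: "'a set \<Rightarrow> ('a set \<Rightarrow> bool) \<Rightarrow> bool" where
  "connected_matroid E indep \<longleftrightarrow> num_components E indep = 1"


section \<open>Crowding\<close>

definition crowd :: "('a set \<Rightarrow> bool) \<Rightarrow> 'a set \<Rightarrow> int" where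
  "crowd indep S = int (card S) - 2 * int (mrank indep S)"

definition crowded :: "('a set \<Rightarrow> bool) \<Rightarrow> 'a set \<Rightarrow> bool" where
  "crowded indep S \<longleftrightarrow> crowd indep S \<ge> 0"

definition summand :: "('a set \<Rightarrow> bool) \<Rightarrow> 'a set \<Rightarrow> 'a set \<Rightarrow> bool" where
  "summand indep T S \<longleftrightarrow> T \<subseteq> S \<and> mrank indep S = mrank indep T + mrank indep (S - T)"

definition overcrowded_in :: "('a set \<Rightarrow> bool) \<Rightarrow> 'a set \<Rightarrow> 'a set \<Rightarrow> bool" where
  "overcrowded_in indep T S \<longleftrightarrow> T \<subseteq> S \<and>
     (crowd indep T > crowd indep S \<or>
      crowd indep T = crowd indep S \<and> \<not> summand indep T S)"

definition crowding_record :: "'a set \<Rightarrow> ('a set \<Rightarrow> bool) \<Rightarrow> 'a set \<Rightarrow> bool" where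
  "crowding_record E indep S \<longleftrightarrow> S \<subseteq> E \<and> (\<forall>T\<subseteq>S. \<not> overcrowded_in indep T S)"

definition minimal_nonempty_crowded ::
    "'a set \<Rightarrow> ('a set \<Rightarrow> bool) \<Rightarrow> 'a set \<Rightarrow> bool" where
  "minimal_nonempty_crowded E indep T \<longleftrightarrow>
     T \<subseteq> E \<and> T \<noteq> {} \<and> crowded indep T \<and>
     (\<forall>S. S \<subset> T \<and> S \<noteq> {} \<longrightarrow> \<not> crowded indep S)"


section \<open>Rational functions in variables indexed by the ground type\<close>

text \<open>
  The variables are wrapped in a copy of the ground type so that this copy can be given an
  arbitrary linear order: the integral domain instance of \<^type>\<open>poly_mapping\<close> asks for one.
  The ring structure does not depend on the order.
\<close>

datatype 'a indet = Indet 'a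

instantiation indet :: (type) linorder
begin

definition indet_wo :: "('a indet \<times> 'a indet) set" where
  "indet_wo = (SOME r. Well_order r \<and> Field r = UNIV)"

definition less_eq_indet :: "'a indet \<Rightarrow> 'a indet \<Rightarrow> bool" where
  "less_eq_indet x y \<longleftrightarrow> (x, y) \<in> indet_wo"

definition less_indet :: "'a indet \<Rightarrow> 'a indet \<Rightarrow> bool" where
  "less_indet x y \<longleftrightarrow> (x, y) \<in> indet_wo \<and> x \<noteq> y"

instance
proof -
  have "Well_order (indet_wo :: 'a indet rel) \<and> Field (indet_wo :: 'a indet rel) = UNIV"
    unfolding indet_wo_def by (rule someI_ex) (rule well_ordering)
  then have lin: "refl (indet_wo :: 'a indet rel)" "trans (indet_wo :: 'a indet rel)"
    "antisym (indet_wo :: 'a indet rel)" "total (indet_wo :: 'a indet rel)"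
    by (auto simp: order_on_defs)
  show "OFCLASS('a indet, linorder_class)"
  proof
    fix x y z :: "'a indet"
    show "(x < y) = (x \<le> y \<and> \<not> y \<le> x)"
      using lin(1,3) by (auto simp: less_eq_indet_def less_indet_def dest: antisymD reflD)
    show "x \<le> x"
      using lin(1) by (auto simp: less_eq_indet_def dest: reflD)
    show "x \<le> y \<Longrightarrow> y \<le> z \<Longrightarrow> x \<le> z"
      using lin(2) by (auto simp: less_eq_indet_def dest: transD)
    show "x \<le> y \<Longrightarrow> y \<le> x \<Longrightarrow> x = y"
      using lin(3) by (auto simp: less_eq_indet_def dest: antisymD)
    show "x \<le> y \<or> y \<le> x"
      using lin(1,4) unfolding less_eq_indet_def total_on_def by (metis UNIV_I reflD)
  qed
qed

end

type_synonym 'a int_mpoly = "('a indet \<Rightarrow>\<^sub>0 nat) \<Rightarrow>\<^sub>0 int"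

type_synonym 'a ratfun = "'a int_mpoly fract"

definition Var :: "'a \<Rightarrow> 'a ratfun" where
  "Var e = Fract (Poly_Mapping.single (Poly_Mapping.single (Indet e) 1) 1) 1"

lemma inj_of_int_ratfun: "inj (of_int :: int \<Rightarrow> 'a ratfun)"
proof (rule injI)
  have nat: "of_nat n = Fract (of_nat n :: 'a int_mpoly) 1" for n
    by (induction n) (simp_all add: Zero_fract_def One_fract_def)
  have int: "of_int k = Fract (of_int k :: 'a int_mpoly) 1" for k
    by (cases k rule: int_diff_cases) (simp add: nat)
  fix k l :: int
  assume "(of_int k :: 'a ratfun) = of_int l"
  then show "k = l"
    by (simp add: int eq_fract)
qed


section \<open>Speyer's g-polynomial\<close>

text \<open>The elementary symmetric polynomial of degree \<open>k\<close> in the family \<open>(v a)\<close>, \<open>a \<in> A\<close>.\<close>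
definition esym :: "nat \<Rightarrow> 'b set \<Rightarrow> ('b \<Rightarrow> 'c :: comm_ring_1) \<Rightarrow> 'c" where
  "esym k A v = (\<Sum>X | X \<subseteq> A \<and> card X = k. \<Prod>a\<in>X. v a)"

text \<open>
  A total ordering of \<open>E\<close> is a list in \<^term>\<open>permutations_of_set E\<close>; list positions count from 0.
\<close>
definition ord_basis :: "('a set \<Rightarrow> bool) \<Rightarrow> 'a list \<Rightarrow> 'a set" where
  "ord_basis indep w = {w ! k | k. k < length w \<and>
     mrank indep (set (take (Suc k) w)) > mrank indep (set (take k w))}"

definition deg :: "'a set \<Rightarrow> ('a list \<Rightarrow> 'a ratfun) \<Rightarrow> 'a ratfun" where
  "deg E f = (\<Sum>w\<in>permutations_of_set E.
     f w / (\<Prod>i<card E - 1. Var (w ! i) - Var (w ! Suc i)))"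

text \<open>
  The integer coefficients of the polynomial appear here as elements of the field of rational
  functions, since that is where \<^const>\<open>deg\<close> takes its values; by
  \<open>inj_of_int_ratfun\<close> no information is lost.
\<close>
definition speyer_g :: "'a set \<Rightarrow> ('a set \<Rightarrow> bool) \<Rightarrow> 'a ratfun poly" where
  "speyer_g E indep =
     (if E = {} then 1
      else if \<exists>e. loop E indep e \<or> coloop E indep e then 0
      else
        let n = card E; r = mrank indep E;
            \<alpha> = (\<lambda>w. - Var (last w));
            x = Var;
            y = (\<lambda>c. - Var c);
            B = ord_basis indep
        in (-1) ^ num_components E indep *
           (\<Sum>i = 1..r. (- [:0, 1:]) ^ i *
             (\<Sum>j = 0..i - 1.
               [: deg E (\<lambda>w. \<alpha> w ^ j * esym (i - j - 1) (E - B w) (\<lambda>c. - y c) *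
                    esym (r - i) (B w) x * esym (n - r) (E - B w) y) :])))"

definition omega :: "'a set \<Rightarrow> ('a set \<Rightarrow> bool) \<Rightarrow> 'a ratfun" where
  "omega E indep = coeff (speyer_g E indep) (mrank indep E)"

end

theory Submission
  imports Defs
begin

text \<open>
  Since a last letter is never in its basis, the alternating sum in the definition of \<open>g\<close> collapses
  and \<open>\<omega>(M)\<close> becomes the sum over words \<open>w\<close>, with non-basis \<open>C\<close> and last letter \<open>x\<close>, of
  \<open>z\<^sub>x (\<Sum>d. z\<^sub>d \<Prod>c. z\<^sub>c\<^sup>2)\<close> divided by the product of consecutive differences, where \<open>d\<close> ranges over
  \<open>C - {x}\<close> and \<open>c\<close> over \<open>C - {x, d}\<close>. Cutting off last letters gives a recursion over subsets \<open>P\<close>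
  of \<open>E\<close> which is solved, by Lagrange interpolation, by multiples of
  \<open>t\<^sup>k / (\<Prod>y\<in>P. z\<^sub>y - t)\<close> with \<open>k\<close> read off from the nullity of \<open>P\<close>. Interpolation is exact while
  \<open>k < |P|\<close>; it has a constant defect when \<open>k = |P|\<close>, that is, when \<open>P\<close> has crowding 0. Such a proper
  nonempty \<open>P\<close> contains exactly one \<open>T\<^sub>i\<close>, and subtracting the same solution for words
  started at \<open>T\<^sub>i\<close> cancels the defect. The outcome is \<open>\<omega>(M) = r - (\<Sum>i. r - |T\<^sub>i|/2)\<close>. Finally every
  \<open>E - {e}\<close> has crowding 0, so the complements of the \<open>T\<^sub>i\<close> partition \<open>E\<close>; they have odd size, hence
  \<open>p\<close> is odd and the sum evaluates to \<open>(p - 1)/2\<close>.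
\<close>

section \<open>Lagrange interpolation of monomials\<close>

text \<open>Up to sign this is the divided difference of \<open>t ^ k\<close> on the nodes
  \<open>z x\<close>, which vanishes below degree \<open>card A - 1\<close> and equals 1 there. The
  induction removes a node through \<open>h A (Suc j) = z a * h A j - h (A - {a}) j\<close>.\<close>

lemma lagrange_sum:
  fixes z :: "'a \<Rightarrow> 'k::field"
  assumes "finite A" "inj_on z A" "k < card A"
  shows "(\<Sum>x\<in>A. z x ^ k / (\<Prod>y\<in>A - {x}. z y - z x)) =
    (if Suc k = card A then (-1) ^ k else 0)"
  using assms
proof (induction "card A" arbitrary: A k rule: less_induct)
  case less
  define h where "h B j = (\<Sum>x\<in>B. z x ^ j / (\<Prod>y\<in>B - {x}. z y - z x))" for B j
  have step: "h A (Suc j) = z a * h A j - h (A - {a}) j" if "a \<in> A" for a j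
  proof -
    have "h A (Suc j) - z a * h A j
        = (\<Sum>x\<in>A. (z x - z a) * (z x ^ j / (\<Prod>y\<in>A - {x}. z y - z x)))"
      unfolding h_def sum_distrib_left sum_subtractf[symmetric]
      by (rule sum.cong) (simp_all add: diff_divide_distrib left_diff_distrib)
    also have "\<dots> = (\<Sum>x\<in>A - {a}. (z x - z a) * (z x ^ j / (\<Prod>y\<in>A - {x}. z y - z x)))"
      using less.prems(1) that by (subst sum.remove[of _ a]) auto
    also have "\<dots> = (\<Sum>x\<in>A - {a}. - (z x ^ j / (\<Prod>y\<in>A - {a} - {x}. z y - z x)))"
    proof (rule sum.cong[OF refl])
      fix x assume x: "x \<in> A - {a}"
      have "(\<Prod>y\<in>A - {x}. z y - z x) = (z a - z x) * (\<Prod>y\<in>A - {x} - {a}. z y - z x)"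
        using less.prems(1) that x by (subst prod.remove[of _ a]) auto
      moreover have "A - {x} - {a} = A - {a} - {x}" by auto
      moreover have "z a \<noteq> z x"
        using less.prems(2) that x by (auto dest: inj_onD)
      ultimately show "(z x - z a) * (z x ^ j / (\<Prod>y\<in>A - {x}. z y - z x))
          = - (z x ^ j / (\<Prod>y\<in>A - {a} - {x}. z y - z x))"
        by (simp add: divide_simps) (simp add: algebra_simps)
    qed
    also have "\<dots> = - h (A - {a}) j"
      unfolding h_def by (simp add: sum_negf)
    finally show ?thesis by (simp add: algebra_simps)
  qed
  have IH: "h (A - {a}) j = (if Suc (Suc j) = card A then (-1) ^ j else 0)"
    if "a \<in> A" "Suc j < card A" for a j
    unfolding h_def using less.hyps[of "A - {a}" j] less.prems(1,2) that
    by (auto simp: inj_on_diff card_Diff_singleton card_gt_0_iff)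
  have low: "h A j = 0" if j: "Suc j < card A" for j
  proof -
    obtain a b where ab: "a \<in> A" "b \<in> A" "a \<noteq> b"
      using j card_le_Suc0_iff_eq[OF less.prems(1)]
      by (metis Suc_leI leD zero_less_Suc le_less_trans Suc_le_mono le0)
    \<comment> \<open>Two nodes give two expressions for \<open>h A (Suc j)\<close>; by induction
      the smaller sums agree, so \<open>z a - z b\<close> annihilates \<open>h A j\<close>.\<close>
    have "z a * h A j - h (A - {a}) j = z b * h A j - h (A - {b}) j"
      using step ab by metis
    then have "z a * h A j = z b * h A j"
      unfolding IH[OF ab(1) j] IH[OF ab(2) j] by (metis diff_add_cancel)
    moreover have "z a \<noteq> z b"
      using ab less.prems(2) by (auto dest: inj_onD)
    ultimately show ?thesis by simp
  qed
  show ?case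
  proof (cases "Suc k = card A")
    case True
    show ?thesis
    proof (cases k)
      case 0
      then obtain a where "A = {a}"
        using True by (metis One_nat_def card_1_singletonE)
      then show ?thesis using 0 by simp
    next
      case (Suc j)
      then obtain a where a: "a \<in> A" using True by fastforce
      have "h A k = - ((-1) ^ j)"
        using step[OF a, of j] low[of j] IH[OF a, of j] Suc True by simp
      then show ?thesis using True Suc by (simp add: h_def)
    qed
  next
    case False
    then show ?thesis using low[of k] less.prems(3) by (simp add: h_def)
  qed
qed

text \<open>A rational function of \<open>t\<close> evaluated at \<open>t = z x\<close>; for
  injective \<open>z\<close> its poles, at the nodes of \<open>A\<close>, are at most
  simple.\<close>

definition simple_pole :: "('a \<Rightarrow> 'k::field) \<Rightarrow> 'a set \<Rightarrow> nat \<Rightarrow> 'a \<Rightarrow> 'k" where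
  "simple_pole z A k x = z x ^ k / (\<Prod>y\<in>A. z y - z x)"

text \<open>Isolate the term of \<open>x\<close> in \<open>lagrange_sum\<close> for the nodes
  \<open>insert x A\<close>. The defect at \<open>k = card A\<close> is the constant polynomial part
  of a quotient whose numerator and denominator have equal degree.\<close>

lemma partial_fractions:
  fixes z :: "'a \<Rightarrow> 'k::field"
  assumes "finite A" "x \<notin> A" "inj_on z (insert x A)" "k \<le> card A"
  shows "(\<Sum>y\<in>A. z y ^ k / ((z y - z x) * (\<Prod>v\<in>A - {y}. z v - z y))) =
    simple_pole z A k x - (if k = card A then (-1) ^ k else 0)"
proof -
  have "(\<Sum>y\<in>insert x A. z y ^ k / (\<Prod>v\<in>insert x A - {y}. z v - z y))
      = (if k = card A then (-1) ^ k else 0)"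
    using lagrange_sum[of "insert x A" z k] assms by auto
  moreover have "(\<Sum>y\<in>insert x A. z y ^ k / (\<Prod>v\<in>insert x A - {y}. z v - z y))
      = simple_pole z A k x + (\<Sum>y\<in>A. z y ^ k / (\<Prod>v\<in>insert x A - {y}. z v - z y))"
    using assms(1,2) by (simp add: simple_pole_def)
  moreover have "(\<Sum>y\<in>A. z y ^ k / (\<Prod>v\<in>insert x A - {y}. z v - z y))
      = (\<Sum>y\<in>A. - (z y ^ k / ((z y - z x) * (\<Prod>v\<in>A - {y}. z v - z y))))"
  proof (rule sum.cong[OF refl])
    fix y assume y: "y \<in> A"
    then have "insert x A - {y} = insert x (A - {y})" using assms(2) by auto
    then have "(\<Prod>v\<in>insert x A - {y}. z v - z y)
        = - ((z y - z x) * (\<Prod>v\<in>A - {y}. z v - z y))"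
      using assms(1,2) by (simp add: algebra_simps)
    then show "z y ^ k / (\<Prod>v\<in>insert x A - {y}. z v - z y)
        = - (z y ^ k / ((z y - z x) * (\<Prod>v\<in>A - {y}. z v - z y)))"
      by simp
  qed
  ultimately show ?thesis by (simp add: sum_negf algebra_simps)
qed


section \<open>Sums over words\<close>

lemma sum_permutations_snoc:
  assumes "finite A" "A \<noteq> {}"
  shows "(\<Sum>w\<in>permutations_of_set A. f w) =
    (\<Sum>x\<in>A. \<Sum>u\<in>permutations_of_set (A - {x}). f (u @ [x]))"
proof -
  \<comment> \<open>\<open>permutations_of_set_nonempty\<close> splits off the first letter;
    reversing all words turns it into the last.\<close>
  have rev: "(\<Sum>w\<in>permutations_of_set B. g w) = (\<Sum>w\<in>permutations_of_set B. g (rev w))"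
    for B and g :: "'a list \<Rightarrow> 'b"
    by (rule sum.reindex_bij_witness[of _ rev rev]) (auto simp: permutations_of_set_def)
  have "(\<Sum>w\<in>permutations_of_set A. f (rev w))
      = (\<Sum>x\<in>A. \<Sum>w\<in>(#) x ` permutations_of_set (A - {x}). f (rev w))"
    unfolding permutations_of_set_nonempty[OF assms(2)]
    using assms(1) by (subst sum.UNION_disjoint) auto
  also have "\<dots> = (\<Sum>x\<in>A. \<Sum>u\<in>permutations_of_set (A - {x}). f (rev u @ [x]))"
    by (simp add: sum.reindex)
  also have "\<dots> = (\<Sum>x\<in>A. \<Sum>u\<in>permutations_of_set (A - {x}). f (u @ [x]))"
    by (subst (2) rev) simp
  finally show ?thesis by (subst rev)
qed

definition path_prod :: "('a \<Rightarrow> 'k::field) \<Rightarrow> 'a list \<Rightarrow> 'k" where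
  "path_prod z w = (\<Prod>i<length w - 1. z (w ! i) - z (w ! Suc i))"

lemma path_prod_singleton [simp]: "path_prod z [x] = 1"
  by (simp add: path_prod_def)

lemma path_prod_snoc: "path_prod z (u @ [y, x]) = path_prod z (u @ [y]) * (z y - z x)"
proof -
  have "path_prod z (u @ [y, x])
      = (\<Prod>i<Suc (length u). z ((u @ [y, x]) ! i) - z ((u @ [y, x]) ! Suc i))"
    by (simp add: path_prod_def)
  also have "\<dots> = (\<Prod>i<length u. z ((u @ [y, x]) ! i) - z ((u @ [y, x]) ! Suc i)) * (z y - z x)"
    by (simp add: nth_append)
  also have "(\<Prod>i<length u. z ((u @ [y, x]) ! i) - z ((u @ [y, x]) ! Suc i))
      = (\<Prod>i<length u. z ((u @ [y]) ! i) - z ((u @ [y]) ! Suc i))"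
    by (rule prod.cong) (auto simp: nth_append less_Suc_eq)
  finally show ?thesis by (simp add: path_prod_def)
qed

text \<open>The letter \<open>x\<close> follows the word: it enters the denominator but not the
  weight. Cutting off the last letter \<open>y\<close> of the word then leaves a sum of the same
  form, with \<open>y\<close> as the following letter.\<close>

definition word_sum :: "('a \<Rightarrow> 'k::field) \<Rightarrow> ('a list \<Rightarrow> 'k) \<Rightarrow> 'a set \<Rightarrow> 'a \<Rightarrow> 'k" where
  "word_sum z f P x = (\<Sum>u\<in>permutations_of_set P. f u / path_prod z (u @ [x]))"

lemma word_sum_empty [simp]: "word_sum z f {} x = f []"
  by (simp add: word_sum_def)

lemma word_sum_rec:
  assumes "finite P" "P \<noteq> {}"
    and "\<And>y u. y \<in> P \<Longrightarrow> u \<in> permutations_of_set (P - {y}) \<Longrightarrow> f (u @ [y]) = g y u"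
  shows "word_sum z f P x = (\<Sum>y\<in>P. word_sum z (g y) (P - {y}) y / (z y - z x))"
  unfolding word_sum_def sum_permutations_snoc[OF assms(1,2)]
  by (intro sum.cong refl) (simp add: path_prod_snoc sum_divide_distrib assms(3))

lemma word_sum_add: "word_sum z (\<lambda>u. f u + g u) P x = word_sum z f P x + word_sum z g P x"
  by (simp add: word_sum_def add_divide_distrib sum.distrib)

lemma word_sum_mult: "word_sum z (\<lambda>u. c * f u) P x = c * word_sum z f P x"
  by (simp add: word_sum_def sum_distrib_left)


section \<open>Rank, nullity and crowding\<close>

context matroid
begin

lemma mrank_le: "(\<And>X. X \<subseteq> S \<Longrightarrow> indep X \<Longrightarrow> card X \<le> k) \<Longrightarrow> S \<subseteq> E \<Longrightarrow> mrank indep S \<le> k"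
  unfolding mrank_def using finite_ground indep_empty finite_subset[of S E]
  by (subst Max_le_iff) (auto intro!: finite_imageI finite_subset[of _ "Pow S"])

lemma card_le_mrank: "X \<subseteq> S \<Longrightarrow> indep X \<Longrightarrow> S \<subseteq> E \<Longrightarrow> card X \<le> mrank indep S"
  unfolding mrank_def using finite_ground finite_subset[of S E]
  by (intro Max_ge) (auto intro!: finite_imageI finite_subset[of _ "Pow S"])

lemma mrank_witness:
  assumes "S \<subseteq> E"
  obtains X where "X \<subseteq> S" "indep X" "card X = mrank indep S"
proof -
  have "finite {X. X \<subseteq> S \<and> indep X}"
    using assms finite_ground finite_subset[of S E]
    by (auto intro: finite_subset[of _ "Pow S"])
  then have "mrank indep S \<in> card ` {X. X \<subseteq> S \<and> indep X}"
    unfolding mrank_def using indep_empty by (intro Max_in) auto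
  then show ?thesis using that by auto
qed

lemma finite_sub: "S \<subseteq> E \<Longrightarrow> finite S"
  using finite_ground finite_subset by blast

lemma mrank_empty [simp]: "mrank indep {} = 0"
  using mrank_le[of "{}" 0] by simp

lemma mrank_le_card: "S \<subseteq> E \<Longrightarrow> mrank indep S \<le> card S"
  by (rule mrank_le) (auto intro: card_mono finite_sub)

lemma mrank_mono: "S \<subseteq> S' \<Longrightarrow> S' \<subseteq> E \<Longrightarrow> mrank indep S \<le> mrank indep S'"
  by (rule mrank_le) (auto intro: card_le_mrank)

lemma mrank_remove:
  assumes "S \<subseteq> E"
  shows "mrank indep S \<le> Suc (mrank indep (S - {x}))"
proof (rule mrank_le[OF _ assms])
  fix X assume X: "X \<subseteq> S" "indep X"
  have "card (X - {x}) \<le> mrank indep (S - {x})"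
    using X assms indep_mono[OF X(2), of "X - {x}"] by (intro card_le_mrank) auto
  then show "card X \<le> Suc (mrank indep (S - {x}))"
    using card_Suc_Diff1[OF finite_sub, of X x] X(1) assms by (cases "x \<in> X") auto
qed

text \<open>If deleting \<open>e\<close> kept the rank, a largest independent subset of
  \<open>E - {e}\<close> would be a basis avoiding \<open>e\<close>.\<close>

lemma coloop_mrank:
  assumes "coloop E indep e"
  shows "mrank indep (E - {e}) < mrank indep E"
proof (rule ccontr)
  assume "\<not> mrank indep (E - {e}) < mrank indep E"
  then have eq: "mrank indep (E - {e}) = mrank indep E"
    using mrank_mono[of "E - {e}" E] by auto
  obtain B where B: "B \<subseteq> E - {e}" "indep B" "card B = mrank indep (E - {e})"
    using mrank_witness[of "E - {e}"] by auto
  have "basis indep B"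
    unfolding basis_def
  proof (intro conjI allI impI)
    fix X assume X: "indep X \<and> B \<subseteq> X"
    then have "card X \<le> card B"
      using card_le_mrank[of X E] indep_subset_ground B(3) eq by auto
    then show "X = B"
      using X card_seteq[of X B] finite_sub indep_subset_ground by auto
  qed (fact B)
  then show False using assms B(1) by (auto simp: coloop_def)
qed

lemma loop_mrank: "loop E indep e \<Longrightarrow> mrank indep {e} = 0"
  using mrank_witness[of "{e}"] by (metis card.empty empty_subsetI insert_subset loop_def subset_singletonD)

end

text \<open>On subsets of \<open>E\<close> the subtraction never truncates, by
  \<open>mrank_le_card\<close>.\<close>

definition nullity :: "('a set \<Rightarrow> bool) \<Rightarrow> 'a set \<Rightarrow> nat" where
  "nullity indep S = card S - mrank indep S"

text \<open>The complement is taken in the letters of the word, not in \<open>E\<close>, so that the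
  notion applies to proper prefixes of an ordering.\<close>

definition nonbasis :: "('a set \<Rightarrow> bool) \<Rightarrow> 'a list \<Rightarrow> 'a set" where
  "nonbasis indep u = set u - ord_basis indep u"

lemma ord_basis_snoc:
  "ord_basis indep (u @ [y]) = ord_basis indep u \<union>
    (if mrank indep (insert y (set u)) > mrank indep (set u) then {y} else {})"
proof -
  have "ord_basis indep (u @ [y]) = (\<lambda>k. (u @ [y]) ! k) ` {k. k < Suc (length u) \<and>
     mrank indep (set (take (Suc k) (u @ [y]))) > mrank indep (set (take k (u @ [y])))}"
    by (auto simp: ord_basis_def)
  also have "{k. k < Suc (length u) \<and>
     mrank indep (set (take (Suc k) (u @ [y]))) > mrank indep (set (take k (u @ [y])))}
    = {k. k < length u \<and> mrank indep (set (take (Suc k) u)) > mrank indep (set (take k u))} \<union>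
      (if mrank indep (insert y (set u)) > mrank indep (set u) then {length u} else {})"
    by (auto simp: less_Suc_eq)
  finally show ?thesis
    by (auto simp: ord_basis_def nth_append image_Un)
qed

lemma ord_basis_subset: "ord_basis indep u \<subseteq> set u"
  by (auto simp: ord_basis_def)

context matroid
begin

lemma nullity_empty [simp]: "nullity indep {} = 0"
  by (simp add: nullity_def)

lemma crowd_nullity: "S \<subseteq> E \<Longrightarrow> crowd indep S = 2 * int (nullity indep S) - int (card S)"
  using mrank_le_card[of S] by (simp add: crowd_def nullity_def of_nat_diff)

text \<open>A new point raises the rank by at most one, hence exactly one of rank and nullity goes
  up, by one.\<close>

lemma nullity_insert:
  assumes "insert y S \<subseteq> E" "y \<notin> S"
  shows "nullity indep (insert y S) =
    (if mrank indep (insert y S) > mrank indep S then nullity indep S else Suc (nullity indep S))"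
  using mrank_remove[OF assms(1), of y] mrank_mono[OF subset_insertI assms(1)] mrank_le_card[of S] assms
    finite_sub[of S]
  by (auto simp: nullity_def card_insert_if)

lemma nonbasis_snoc:
  assumes "insert y (set u) \<subseteq> E" "y \<notin> set u"
  shows "nonbasis indep (u @ [y]) =
    (if mrank indep (insert y (set u)) > mrank indep (set u) then nonbasis indep u
     else insert y (nonbasis indep u))"
  using assms ord_basis_subset[of indep u]
  by (auto simp: nonbasis_def ord_basis_snoc)

text \<open>A letter is left out of the basis exactly when it raises the nullity of the
  prefix.\<close>

lemma card_nonbasis:
  "distinct u \<Longrightarrow> set u \<subseteq> E \<Longrightarrow> card (nonbasis indep u) = nullity indep (set u)"
proof (induction u rule: rev_induct)
  case Nil
  then show ?case by (simp add: nonbasis_def)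
next
  case (snoc y u)
  have "finite (nonbasis indep u)" "y \<notin> nonbasis indep u"
    using snoc.prems by (auto simp: nonbasis_def)
  then show ?case
    using snoc nonbasis_snoc[of y u] nullity_insert[of y "set u"] by auto
qed

end


section \<open>Weights of words\<close>

definition sq_weight :: "('a set \<Rightarrow> bool) \<Rightarrow> ('a \<Rightarrow> 'k::field) \<Rightarrow> 'a list \<Rightarrow> 'k" where
  "sq_weight indep z u = (\<Prod>c\<in>nonbasis indep u. z c ^ 2)"

text \<open>Half the derivative of \<open>sq_weight\<close> when all variables are shifted by the
  same amount; such a shift preserves the denominators \<open>path_prod\<close>.\<close>

definition der_weight :: "('a set \<Rightarrow> bool) \<Rightarrow> ('a \<Rightarrow> 'k::field) \<Rightarrow> 'a list \<Rightarrow> 'k" where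
  "der_weight indep z u = (\<Sum>d\<in>nonbasis indep u. z d * (\<Prod>c\<in>nonbasis indep u - {d}. z c ^ 2))"

text \<open>
  The empty core, with sign \<open>1\<close>, carries the main term; the others, with sign \<open>-1\<close>, its corrections.
\<close>

definition cores :: "'a set \<Rightarrow> ('a set \<Rightarrow> bool) \<Rightarrow> 'a set \<Rightarrow> 'a set set" where
  "cores E indep P = {T. T \<subseteq> P \<and> (T = {} \<or> minimal_nonempty_crowded E indep T)}"

definition core_sign :: "'a set \<Rightarrow> 'k::field" where
  "core_sign T = (if T = {} then 1 else - 1)"

lemma finite_cores: "finite P \<Longrightarrow> finite (cores E indep P)"
  by (rule finite_subset[of _ "Pow P"]) (auto simp: cores_def)

lemma cores_remove: "cores E indep (P - {y}) = {T \<in> cores E indep P. y \<notin> T}"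
  by (auto simp: cores_def)

lemma simple_pole_power: "z y ^ j * simple_pole z A k y = simple_pole z A (j + k) y"
  by (simp add: simple_pole_def power_add)

text \<open>One step of the recursion, applied to a combination of poles. The cores of
  \<open>P - {y}\<close> are the cores of \<open>P\<close> avoiding \<open>y\<close>, so after
  exchanging the sums \<open>y\<close> runs over \<open>P - T\<close> and
  \<open>partial_fractions\<close> applies; the last sum collects the defects.\<close>

lemma sum_cores_poles:
  fixes z :: "'a \<Rightarrow> 'k::field"
  assumes "finite P" "x \<notin> P" "inj_on z (insert x P)"
    and "\<And>T. T \<in> cores E indep P \<Longrightarrow> k T \<le> card (P - T)"
  shows "(\<Sum>y\<in>P. (\<Sum>T\<in>cores E indep (P - {y}). c T * simple_pole z (P - {y} - T) (k T) y) / (z y - z x))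
    = (\<Sum>T\<in>cores E indep P. c T * simple_pole z (P - T) (k T) x)
      - (\<Sum>T\<in>cores E indep P. c T * (if k T = card (P - T) then (-1) ^ k T else 0))"
proof -
  have "(\<Sum>y\<in>P. (\<Sum>T\<in>cores E indep (P - {y}). c T * simple_pole z (P - {y} - T) (k T) y) / (z y - z x))
      = (\<Sum>y\<in>P. \<Sum>T\<in>{T \<in> cores E indep P. y \<notin> T}.
          c T * (z y ^ k T / ((z y - z x) * (\<Prod>v\<in>P - T - {y}. z v - z y))))"
    unfolding cores_remove sum_divide_distrib
  proof (intro sum.cong refl)
    fix y T
    have "P - {y} - T = P - T - {y}" by auto
    then show "c T * simple_pole z (P - {y} - T) (k T) y / (z y - z x)
        = c T * (z y ^ k T / ((z y - z x) * (\<Prod>v\<in>P - T - {y}. z v - z y)))"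
      by (simp add: simple_pole_def mult.commute)
  qed
  also have "\<dots> = (\<Sum>T\<in>cores E indep P. \<Sum>y\<in>{y \<in> P. y \<notin> T}.
          c T * (z y ^ k T / ((z y - z x) * (\<Prod>v\<in>P - T - {y}. z v - z y))))"
    by (rule sum.swap_restrict) (use assms(1) in \<open>auto intro: finite_cores\<close>)
  also have "\<dots> = (\<Sum>T\<in>cores E indep P. c T *
      (simple_pole z (P - T) (k T) x - (if k T = card (P - T) then (-1) ^ k T else 0)))"
  proof (rule sum.cong[OF refl])
    fix T assume T: "T \<in> cores E indep P"
    have eq: "{y \<in> P. y \<notin> T} = P - T" by auto
    have inj: "inj_on z (insert x (P - T))"
      by (rule inj_on_subset[OF assms(3)]) auto
    show "(\<Sum>y\<in>{y \<in> P. y \<notin> T}.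
          c T * (z y ^ k T / ((z y - z x) * (\<Prod>v\<in>P - T - {y}. z v - z y)))) = c T *
      (simple_pole z (P - T) (k T) x - (if k T = card (P - T) then (-1) ^ k T else 0))"
      unfolding eq sum_distrib_left[symmetric]
      using partial_fractions[OF _ _ inj assms(4)[OF T]] assms(1,2) by simp
  qed
  finally show ?thesis by (simp add: right_diff_distrib sum_subtractf)
qed

text \<open>Half the product rule for \<open>a ^ (2 * d) * a ^ (2 * m)\<close>. Where an exponent
  truncates at 0, its coefficient is 0.\<close>

lemma double_power_step:
  fixes a :: "'k::field"
  shows "a ^ (2 * d) * (of_nat m * a ^ (2 * m - 1)) + of_nat d * a ^ (2 * d - 1) * a ^ (2 * m)
    = of_nat (m + d) * a ^ (2 * (m + d) - 1)"
proof (cases "m = 0 \<or> d = 0")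
  case False
  then have "2 * d + (2 * m - 1) = 2 * (m + d) - 1" "2 * d - 1 + 2 * m = 2 * (m + d) - 1"
    by auto
  then have "a ^ (2 * d) * a ^ (2 * m - 1) = a ^ (2 * (m + d) - 1)"
    "a ^ (2 * d - 1) * a ^ (2 * m) = a ^ (2 * (m + d) - 1)"
    by (metis power_add)+
  then show ?thesis
    by (metis (no_types, lifting) mult.assoc mult.left_commute of_nat_add distrib_right)
qed auto

section \<open>Growth of nullity and weights under one more letter\<close>

context matroid
begin

lemma nullity_mono:
  assumes "S \<subseteq> S'" "S' \<subseteq> E"
  shows "nullity indep S \<le> nullity indep S'"
proof -
  have "nullity indep S \<le> nullity indep (S \<union> F)" if "finite F" "S \<union> F \<subseteq> E" for F
    using that
  proof (induction F rule: finite_induct)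
    case (insert x F)
    show ?case
    proof (cases "x \<in> S")
      case True
      then show ?thesis using insert by (simp add: insert_absorb)
    next
      case False
      then show ?thesis using insert nullity_insert[of x "S \<union> F"] by auto
    qed
  qed simp
  from this[of "S' - S"] show ?thesis
    using assms finite_sub[of S'] by (simp add: Un_absorb1)
qed

text \<open>The nullity difference is 1 if \<open>y\<close> joins the nonbasis and 0 otherwise, so
  one formula covers both cases.\<close>

lemma sq_weight_snoc:
  assumes "insert y (set u) \<subseteq> E" "y \<notin> set u"
  shows "sq_weight indep z (u @ [y]) =
    z y ^ (2 * (nullity indep (insert y (set u)) - nullity indep (set u))) * sq_weight indep z u"
proof -
  have "finite (nonbasis indep u)" "y \<notin> nonbasis indep u"
    using assms by (auto simp: nonbasis_def)
  then show ?thesis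
    unfolding sq_weight_def nonbasis_snoc[OF assms] nullity_insert[OF assms] by simp
qed

text \<open>The product rule for the derivation behind \<open>der_weight\<close>.\<close>

lemma der_weight_snoc:
  assumes "insert y (set u) \<subseteq> E" "y \<notin> set u"
  defines "\<delta> \<equiv> nullity indep (insert y (set u)) - nullity indep (set u)"
  shows "der_weight indep z (u @ [y]) = z y ^ (2 * \<delta>) * der_weight indep z u
    + of_nat \<delta> * z y ^ (2 * \<delta> - 1) * sq_weight indep z u"
proof (cases "mrank indep (insert y (set u)) > mrank indep (set u)")
  case True
  then show ?thesis
    unfolding der_weight_def \<delta>_def nonbasis_snoc[OF assms(1,2)] nullity_insert[OF assms(1,2)]
    by simp
next
  case False
  have N: "finite (nonbasis indep u)" "y \<notin> nonbasis indep u"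
    using assms by (auto simp: nonbasis_def)
  have \<delta>: "\<delta> = 1"
    using False nullity_insert[OF assms(1,2)] by (simp add: \<delta>_def)
  have "(\<Sum>d\<in>nonbasis indep u. z d * (\<Prod>c\<in>insert y (nonbasis indep u) - {d}. z c ^ 2))
      = (\<Sum>d\<in>nonbasis indep u. z y ^ 2 * (z d * (\<Prod>c\<in>nonbasis indep u - {d}. z c ^ 2)))"
  proof (rule sum.cong[OF refl])
    fix d assume "d \<in> nonbasis indep u"
    then have "insert y (nonbasis indep u) - {d} = insert y (nonbasis indep u - {d})"
      using N by auto
    then show "z d * (\<Prod>c\<in>insert y (nonbasis indep u) - {d}. z c ^ 2)
        = z y ^ 2 * (z d * (\<Prod>c\<in>nonbasis indep u - {d}. z c ^ 2))"
      using N by simp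
  qed
  then show ?thesis
    using False N unfolding der_weight_def sq_weight_def nonbasis_snoc[OF assms(1,2)] \<delta>
    by (simp add: sum_distrib_left)
qed

end

section \<open>Matroids whose proper subsets have nonpositive crowding\<close>

text \<open>The enumeration of the minimal crowded sets is replaced by a condition on pairs of them;
  their number becomes \<open>card (Collect minimal)\<close>.\<close>

locale almost_balanced_matroid = matroid E indep for E :: "'a set" and indep +
  assumes mrank_pos: "mrank indep E > 0"
    and card_ground: "card E = 2 * mrank indep E + 1"
    and crowd_proper: "S \<subset> E \<Longrightarrow> crowd indep S \<le> 0"
    and minimal_cover: "minimal_nonempty_crowded E indep T \<Longrightarrow>
      minimal_nonempty_crowded E indep T' \<Longrightarrow> T \<noteq> T' \<Longrightarrow> T \<union> T' = E"
begin

abbreviation "minimal \<equiv> minimal_nonempty_crowded E indep"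

abbreviation "\<nu> \<equiv> nullity indep"

lemma nullity_proper: "S \<subset> E \<Longrightarrow> 2 * \<nu> S \<le> card S"
  using crowd_proper[of S] crowd_nullity[of S] by auto

text \<open>\<open>E - {e}\<close> has twice as many elements as the rank of \<open>E\<close>, so
  nonpositive crowding forces it to have full rank. In particular the last letter of an ordering is
  never in its basis.\<close>

lemma nullity_remove:
  assumes "e \<in> E"
  shows "\<nu> (E - {e}) = mrank indep E" "mrank indep (E - {e}) = mrank indep E"
    "crowd indep (E - {e}) = 0"
proof -
  have "crowd indep (E - {e}) \<le> 0"
    using assms by (intro crowd_proper) auto
  moreover have "mrank indep (E - {e}) \<le> mrank indep E"
    by (rule mrank_mono) auto
  moreover have "card (E - {e}) = 2 * mrank indep E"
    using assms card_ground finite_ground by simp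
  ultimately show "mrank indep (E - {e}) = mrank indep E" "crowd indep (E - {e}) = 0"
    "\<nu> (E - {e}) = mrank indep E"
    unfolding crowd_def nullity_def by linarith+
qed

section \<open>Minimal crowded sets and cores\<close>

lemma ex_minimal:
  assumes "S \<subseteq> E" "S \<noteq> {}" "crowd indep S \<ge> 0"
  obtains T where "minimal T" "T \<subseteq> S"
proof -
  define \<S> where "\<S> = {X. X \<subseteq> S \<and> X \<noteq> {} \<and> crowd indep X \<ge> 0}"
  have "finite \<S>" "\<S> \<noteq> {}"
    using assms finite_sub[OF assms(1)] by (auto simp: \<S>_def)
  then obtain T where T: "T \<in> \<S>" "\<forall>X\<in>\<S>. X \<subseteq> T \<longrightarrow> T = X"
    using finite_has_minimal[of \<S>] by blast
  have "\<not> crowded indep X" if "X \<subset> T" "X \<noteq> {}" for X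
  proof
    assume "crowded indep X"
    then have "X \<in> \<S>"
      using that T(1) by (auto simp: \<S>_def crowded_def)
    then show False using T(2) that(1) by blast
  qed
  then have "minimal T"
    using T(1) assms(1) by (auto simp: minimal_nonempty_crowded_def crowded_def \<S>_def)
  then show ?thesis using that T(1) by (auto simp: \<S>_def)
qed

text \<open>\<open>E\<close> is not minimal, because each \<open>E - {e}\<close> is a smaller
  nonempty crowded set.\<close>

lemma minimal_proper:
  assumes "minimal T"
  shows "T \<subset> E"
proof -
  have "E \<noteq> {}" using card_ground by (metis card.empty add_eq_0_iff_both_eq_0 zero_neq_one)
  then obtain e where e: "e \<in> E" by blast
  have "card (E - {e}) \<noteq> 0"
    using e card_ground mrank_pos finite_ground by simp
  then have "E - {e} \<noteq> {}" by (metis card.empty)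
  moreover have "E - {e} \<subset> E" using e by blast
  moreover have "crowded indep (E - {e})"
    using nullity_remove(3)[OF e] by (simp add: crowded_def)
  ultimately have "T \<noteq> E"
    using assms unfolding minimal_nonempty_crowded_def by blast
  then show ?thesis using assms by (auto simp: minimal_nonempty_crowded_def)
qed

lemma crowd_minimal: "minimal T \<Longrightarrow> crowd indep T = 0"
  using crowd_proper[OF minimal_proper, of T]
  by (simp add: minimal_nonempty_crowded_def crowded_def)

lemma card_core: "T \<in> cores E indep P \<Longrightarrow> card T = 2 * \<nu> T"
  using crowd_minimal[of T] crowd_nullity[of T] minimal_proper[of T]
  by (auto simp: cores_def)

text \<open>\<open>P\<close> has crowding 0 and so contains a minimal crowded set, but only one,
  since two of them would cover \<open>E\<close>. The signs of this set and of the empty core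
  cancel.\<close>

lemma sum_core_sign:
  assumes "P \<subset> E" "P \<noteq> {}" "card P = 2 * \<nu> P"
  shows "(\<Sum>T\<in>cores E indep P. core_sign T) = (0 :: 'k::field)"
proof -
  have "crowd indep P = 0"
    using assms crowd_nullity[of P] by auto
  then obtain T where T: "minimal T" "T \<subseteq> P"
    by (rule_tac ex_minimal[of P]) (use assms in simp_all)
  have "T' = T" if "minimal T'" "T' \<subseteq> P" for T'
    using minimal_cover[OF T(1) that(1)] T(2) that(2) assms(1) by auto
  then have "cores E indep P = {{}, T}"
    using T unfolding cores_def by blast
  moreover have "T \<noteq> {}" using T(1) by (auto simp: minimal_nonempty_crowded_def)
  ultimately show ?thesis by (simp add: core_sign_def)
qed

text \<open>Induction on \<open>card P\<close>, cutting off the last letter \<open>y\<close>. Its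
  factor, a power of \<open>z y\<close>, raises the exponent from the nullity of
  \<open>P - {y}\<close> to that of \<open>P\<close>, and \<open>sum_cores_poles\<close> sums over
  \<open>y\<close>; the defects cancel by \<open>sum_core_sign\<close>.\<close>

lemma word_sum_sq_weight:
  fixes z :: "'a \<Rightarrow> 'k::field"
  assumes "inj_on z E" "P \<subset> E" "x \<in> E - P"
  shows "word_sum z (sq_weight indep z) P x =
    (\<Sum>T\<in>cores E indep P. core_sign T * simple_pole z (P - T) (2 * (\<nu> P - \<nu> T)) x)"
  using assms(2,3)
proof (induction "card P" arbitrary: P x rule: less_induct)
  case less
  have P: "P \<subseteq> E" "finite P" using less.prems finite_sub by auto
  show ?case
  proof (cases "P = {}")
    case True
    moreover have "cores E indep {} = {{}}" by (auto simp: cores_def)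
    ultimately show ?thesis
      by (simp add: sq_weight_def nonbasis_def simple_pole_def core_sign_def)
  next
    case False
    define g where "g y u = z y ^ (2 * (\<nu> P - \<nu> (P - {y}))) * sq_weight indep z u" for y u
    have snoc: "sq_weight indep z (u @ [y]) = g y u"
      if "y \<in> P" "u \<in> permutations_of_set (P - {y})" for y u
      using sq_weight_snoc[of y u z] that P(1)
      by (auto simp: g_def permutations_of_set_def insert_absorb)
    have step: "word_sum z (g y) (P - {y}) y =
      (\<Sum>T\<in>cores E indep (P - {y}). core_sign T * simple_pole z (P - {y} - T) (2 * (\<nu> P - \<nu> T)) y)"
      if y: "y \<in> P" for y
    proof -
      have "word_sum z (g y) (P - {y}) y = z y ^ (2 * (\<nu> P - \<nu> (P - {y}))) *
        (\<Sum>T\<in>cores E indep (P - {y}). core_sign T * simple_pole z (P - {y} - T) (2 * (\<nu> (P - {y}) - \<nu> T)) y)"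
        unfolding g_def word_sum_mult
        using y P less.prems(1) card_Diff1_less[of P y]
        by (subst less.hyps) auto
      also have "\<dots> = (\<Sum>T\<in>cores E indep (P - {y}). core_sign T *
          simple_pole z (P - {y} - T) (2 * (\<nu> P - \<nu> T)) y)"
        unfolding sum_distrib_left
      proof (rule sum.cong[OF refl])
        fix T assume "T \<in> cores E indep (P - {y})"
        \<comment> \<open>Monotonicity of the nullity makes the truncated differences add
          up.\<close>
        then have "\<nu> T \<le> \<nu> (P - {y})" "\<nu> (P - {y}) \<le> \<nu> P"
          using P(1) by (auto simp: cores_def intro: nullity_mono)
        then have "2 * (\<nu> P - \<nu> (P - {y})) + 2 * (\<nu> (P - {y}) - \<nu> T) = 2 * (\<nu> P - \<nu> T)"
          by simp
        then show "z y ^ (2 * (\<nu> P - \<nu> (P - {y}))) *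
          (core_sign T * simple_pole z (P - {y} - T) (2 * (\<nu> (P - {y}) - \<nu> T)) y) =
          core_sign T * simple_pole z (P - {y} - T) (2 * (\<nu> P - \<nu> T)) y"
          using simple_pole_power[of z y "2 * (\<nu> P - \<nu> (P - {y}))" "P - {y} - T"]
          by (metis mult.left_commute)
      qed
      finally show ?thesis .
    qed
    have inj: "inj_on z (insert x P)"
      by (rule inj_on_subset[OF assms(1)]) (use less.prems in auto)
    have card: "card (P - T) = card P - 2 * \<nu> T" "2 * \<nu> T \<le> card P" "\<nu> T \<le> \<nu> P"
      if "T \<in> cores E indep P" for T
    proof -
      have "T \<subseteq> P" using that by (auto simp: cores_def)
      then show "card (P - T) = card P - 2 * \<nu> T" "2 * \<nu> T \<le> card P" "\<nu> T \<le> \<nu> P"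
        using card_core[OF that] P nullity_mono[of T P] card_mono[of P T]
        by (auto simp: card_Diff_subset finite_subset)
    qed
    \<comment> \<open>Since \<open>card T = 2 * \<nu> T\<close>, a defect occurs for one core
      exactly when it occurs for all, namely when \<open>P\<close> has crowding 0. As an even power
      of -1 it is then 1.\<close>
    have "(\<Sum>T\<in>cores E indep P. core_sign T *
        (if 2 * (\<nu> P - \<nu> T) = card (P - T) then (-1) ^ (2 * (\<nu> P - \<nu> T)) else 0))
      = (\<Sum>T\<in>cores E indep P. core_sign T * (if card P = 2 * \<nu> P then 1 else 0 :: 'k))"
    proof (rule sum.cong[OF refl])
      fix T assume "T \<in> cores E indep P"
      then have "2 * (\<nu> P - \<nu> T) = card (P - T) \<longleftrightarrow> card P = 2 * \<nu> P"
        using card[of T] by auto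
      then show "core_sign T *
        (if 2 * (\<nu> P - \<nu> T) = card (P - T) then (-1) ^ (2 * (\<nu> P - \<nu> T)) else 0)
        = core_sign T * (if card P = 2 * \<nu> P then 1 else 0 :: 'k)"
        by simp
    qed
    also have "\<dots> = 0"
      using sum_core_sign[OF less.prems(1) False] by (auto simp: sum_distrib_right[symmetric])
    finally have boundary: "(\<Sum>T\<in>cores E indep P. core_sign T *
        (if 2 * (\<nu> P - \<nu> T) = card (P - T) then (-1) ^ (2 * (\<nu> P - \<nu> T)) else 0)) = (0 :: 'k)" .
    have "2 * (\<nu> P - \<nu> T) \<le> card (P - T)" if "T \<in> cores E indep P" for T
      using card[OF that] nullity_proper[OF less.prems(1)] by auto
    from sum_cores_poles[where c = core_sign, OF P(2) _ inj this]
    show ?thesis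
      using less.prems(2) boundary
      using word_sum_rec[where f = "sq_weight indep z" and g = g, OF P(2) False snoc]
      by (simp add: step)
  qed
qed

text \<open>
  Where the subtraction in the exponent truncates, the coefficient vanishes.
\<close>

lemma word_sum_der_weight:
  fixes z :: "'a \<Rightarrow> 'k::field"
  assumes "inj_on z E" "P \<subset> E" "x \<in> E - P"
  shows "word_sum z (der_weight indep z) P x =
    (\<Sum>T\<in>cores E indep P. core_sign T * of_nat (\<nu> P - \<nu> T)
      * simple_pole z (P - T) (2 * (\<nu> P - \<nu> T) - 1) x)"
  using assms(2,3)
proof (induction "card P" arbitrary: P x rule: less_induct)
  case less
  have P: "P \<subseteq> E" "finite P" using less.prems finite_sub by auto
  show ?case
  proof (cases "P = {}")
    case True
    moreover have "cores E indep {} = {{}}" by (auto simp: cores_def)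
    ultimately show ?thesis
      by (simp add: der_weight_def nonbasis_def)
  next
    case False
    define \<delta> where "\<delta> y = \<nu> P - \<nu> (P - {y})" for y
    define g where "g y u = z y ^ (2 * \<delta> y) * der_weight indep z u
      + of_nat (\<delta> y) * z y ^ (2 * \<delta> y - 1) * sq_weight indep z u" for y u
    have snoc: "der_weight indep z (u @ [y]) = g y u"
      if "y \<in> P" "u \<in> permutations_of_set (P - {y})" for y u
      using der_weight_snoc[of y u z] that P(1)
      by (auto simp: g_def \<delta>_def permutations_of_set_def insert_absorb)
    have step: "word_sum z (g y) (P - {y}) y =
      (\<Sum>T\<in>cores E indep (P - {y}). core_sign T * of_nat (\<nu> P - \<nu> T)
        * simple_pole z (P - {y} - T) (2 * (\<nu> P - \<nu> T) - 1) y)"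
      if y: "y \<in> P" for y
    proof -
      have y': "P - {y} \<subset> E" "y \<in> E - (P - {y})"
        using y P(1) by auto
      note der = less.hyps[OF card_Diff1_less[OF P(2) y] y']
      note sq = word_sum_sq_weight[OF assms(1) y']
      have "word_sum z (g y) (P - {y}) y = z y ^ (2 * \<delta> y) *
        (\<Sum>T\<in>cores E indep (P - {y}). core_sign T * of_nat (\<nu> (P - {y}) - \<nu> T)
          * simple_pole z (P - {y} - T) (2 * (\<nu> (P - {y}) - \<nu> T) - 1) y)
        + of_nat (\<delta> y) * z y ^ (2 * \<delta> y - 1) *
        (\<Sum>T\<in>cores E indep (P - {y}). core_sign T
          * simple_pole z (P - {y} - T) (2 * (\<nu> (P - {y}) - \<nu> T)) y)"
        unfolding g_def word_sum_mult word_sum_add der sq ..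
      also have "\<dots> = (\<Sum>T\<in>cores E indep (P - {y}). core_sign T * of_nat (\<nu> P - \<nu> T)
        * simple_pole z (P - {y} - T) (2 * (\<nu> P - \<nu> T) - 1) y)"
        unfolding sum_distrib_left sum.distrib[symmetric]
      proof (rule sum.cong[OF refl])
        fix T assume "T \<in> cores E indep (P - {y})"
        then have "\<nu> T \<le> \<nu> (P - {y})" "\<nu> (P - {y}) \<le> \<nu> P"
          using P(1) by (auto simp: cores_def intro: nullity_mono)
        then obtain m where m: "\<nu> (P - {y}) - \<nu> T = m" "\<nu> P - \<nu> T = m + \<delta> y"
          by (auto simp: \<delta>_def)
        \<comment> \<open>The denominator does not depend on the exponent; once it is factored out,
          \<open>double_power_step\<close> remains.\<close>
        define D where "D = inverse (\<Prod>v\<in>P - {y} - T. z v - z y)"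
        have pole: "simple_pole z (P - {y} - T) k y = z y ^ k * D" for k
          by (simp add: simple_pole_def D_def divide_inverse)
        show "z y ^ (2 * \<delta> y) * (core_sign T * of_nat (\<nu> (P - {y}) - \<nu> T)
              * simple_pole z (P - {y} - T) (2 * (\<nu> (P - {y}) - \<nu> T) - 1) y)
            + of_nat (\<delta> y) * z y ^ (2 * \<delta> y - 1) * (core_sign T
              * simple_pole z (P - {y} - T) (2 * (\<nu> (P - {y}) - \<nu> T)) y)
            = core_sign T * of_nat (\<nu> P - \<nu> T)
              * simple_pole z (P - {y} - T) (2 * (\<nu> P - \<nu> T) - 1) y"
          unfolding m pole
          using arg_cong[OF double_power_step[of "z y" "\<delta> y" m], of "\<lambda>t. core_sign T * D * t"]
          by (simp add: algebra_simps)
      qed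
      finally show ?thesis .
    qed
    have inj: "inj_on z (insert x P)"
      by (rule inj_on_subset[OF assms(1)]) (use less.prems in auto)
    have card: "2 * (\<nu> P - \<nu> T) \<le> card (P - T)" if "T \<in> cores E indep P" for T
    proof -
      have "T \<subseteq> P" using that by (auto simp: cores_def)
      then show "2 * (\<nu> P - \<nu> T) \<le> card (P - T)"
        using card_core[OF that] P nullity_proper[OF less.prems(1)]
        by (auto simp: card_Diff_subset finite_subset)
    qed
    \<comment> \<open>The exponent is one lower than for the squares, so interpolation is exact for
      every core with nonzero coefficient and no cancellation between cores is called for.\<close>
    have boundary: "(\<Sum>T\<in>cores E indep P. core_sign T * of_nat (\<nu> P - \<nu> T) *
        (if 2 * (\<nu> P - \<nu> T) - 1 = card (P - T) then (-1) ^ (2 * (\<nu> P - \<nu> T) - 1) else 0)) = (0 :: 'k)"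
    proof (rule sum.neutral, rule ballI)
      fix T assume "T \<in> cores E indep P"
      from card[OF this] have "\<nu> P - \<nu> T = 0 \<or> 2 * (\<nu> P - \<nu> T) - 1 \<noteq> card (P - T)"
        by linarith
      then show "core_sign T * of_nat (\<nu> P - \<nu> T) *
        (if 2 * (\<nu> P - \<nu> T) - 1 = card (P - T) then (-1) ^ (2 * (\<nu> P - \<nu> T) - 1) else 0) = (0 :: 'k)"
        by auto
    qed
    have "2 * (\<nu> P - \<nu> T) - 1 \<le> card (P - T)" if "T \<in> cores E indep P" for T
      using card[OF that] by linarith
    from sum_cores_poles[where c = "\<lambda>T. core_sign T * of_nat (\<nu> P - \<nu> T)", OF P(2) _ inj this]
    show ?thesis
      using less.prems(2) boundary
      using word_sum_rec[where f = "der_weight indep z" and g = g, OF P(2) False snoc]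
      by (simp add: step)
  qed
qed

section \<open>Summation over the last letter\<close>

lemma core_nullity:
  assumes "T \<in> cores E indep E"
  shows "\<nu> T \<le> mrank indep E" "card (E - T) = Suc (2 * (mrank indep E - \<nu> T))"
proof -
  have "T \<subset> E"
    using assms minimal_proper card_ground by (auto simp: cores_def)
  then show "\<nu> T \<le> mrank indep E" "card (E - T) = Suc (2 * (mrank indep E - \<nu> T))"
    using card_core[OF assms] psubset_card_mono[OF finite_ground, of T] card_ground
    by (auto simp: card_Diff_subset finite_sub)
qed

text \<open>The factor \<open>z x\<close> raises the exponent to \<open>2 * m T\<close>, one less
  than the number of nodes in \<open>E - T\<close>. This is the top case of
  \<open>lagrange_sum\<close>, where the value is an even power of -1.\<close>

lemma sum_word_sum_der_weight:
  fixes z :: "'a \<Rightarrow> 'k::field"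
  assumes "inj_on z E"
  shows "(\<Sum>x\<in>E. z x * word_sum z (der_weight indep z) (E - {x}) x) =
    (\<Sum>T\<in>cores E indep E. core_sign T * of_nat (mrank indep E - \<nu> T))"
proof -
  define m where "m T = mrank indep E - \<nu> T" for T
  have "(\<Sum>x\<in>E. z x * word_sum z (der_weight indep z) (E - {x}) x)
      = (\<Sum>x\<in>E. \<Sum>T\<in>{T \<in> cores E indep E. x \<notin> T}. core_sign T * of_nat (m T)
          * (z x ^ (2 * m T) / (\<Prod>v\<in>E - T - {x}. z v - z x)))"
  proof (rule sum.cong[OF refl])
    fix x assume x: "x \<in> E"
    then have x': "E - {x} \<subset> E" "x \<in> E - (E - {x})" by auto
    show "z x * word_sum z (der_weight indep z) (E - {x}) x
        = (\<Sum>T\<in>{T \<in> cores E indep E. x \<notin> T}. core_sign T * of_nat (m T)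
          * (z x ^ (2 * m T) / (\<Prod>v\<in>E - T - {x}. z v - z x)))"
      unfolding word_sum_der_weight[OF assms x'] sum_distrib_left cores_remove nullity_remove(1)[OF x]
        m_def[symmetric]
    proof (rule sum.cong[OF refl])
      fix T
      have eq: "E - {x} - T = E - T - {x}" by auto
      show "z x * (core_sign T * of_nat (m T) * simple_pole z (E - {x} - T) (2 * m T - 1) x)
        = core_sign T * of_nat (m T) * (z x ^ (2 * m T) / (\<Prod>v\<in>E - T - {x}. z v - z x))"
        \<comment> \<open>At \<open>m T = 0\<close> the exponent \<open>2 * m T - 1\<close>
          truncates to 0, but the coefficient vanishes as well.\<close>
        unfolding eq simple_pole_def by (cases "m T") simp_all
    qed
  qed
  also have "\<dots> = (\<Sum>T\<in>cores E indep E. \<Sum>x\<in>{x \<in> E. x \<notin> T}. core_sign T * of_nat (m T)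
          * (z x ^ (2 * m T) / (\<Prod>v\<in>E - T - {x}. z v - z x)))"
    by (rule sum.swap_restrict) (use finite_ground in \<open>auto intro: finite_cores\<close>)
  also have "\<dots> = (\<Sum>T\<in>cores E indep E. core_sign T * of_nat (m T))"
  proof (rule sum.cong[OF refl])
    fix T assume T: "T \<in> cores E indep E"
    have eq: "{x \<in> E. x \<notin> T} = E - T" by auto
    have "(\<Sum>x\<in>E - T. z x ^ (2 * m T) / (\<Prod>v\<in>E - T - {x}. z v - z x)) = 1"
      using lagrange_sum[of "E - T" z "2 * m T"] core_nullity[OF T] finite_ground
        inj_on_subset[OF assms, of "E - T"] by (simp add: m_def)
    then show "(\<Sum>x\<in>{x \<in> E. x \<notin> T}. core_sign T * of_nat (m T)
          * (z x ^ (2 * m T) / (\<Prod>v\<in>E - T - {x}. z v - z x))) = core_sign T * of_nat (m T)"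
      unfolding eq sum_distrib_left[symmetric] by simp
  qed
  finally show ?thesis by (simp add: m_def)
qed

section \<open>Complements of the minimal crowded sets, and crowding records\<close>

lemma finite_minimal: "finite (Collect minimal)"
proof (rule finite_subset)
  show "Collect minimal \<subseteq> Pow E"
    unfolding minimal_nonempty_crowded_def by blast
qed (use finite_ground in simp)

text \<open>The deletion of a point is crowded, so the complements of the minimal crowded sets cover.\<close>

lemma sum_card_complements: "(\<Sum>T\<in>Collect minimal. card (E - T)) = card E"
proof -
  have "E \<subseteq> (\<Union>T\<in>Collect minimal. E - T)"
  proof
    fix e assume e: "e \<in> E"
    have "card (E - {e}) \<noteq> 0"
      using e card_ground mrank_pos finite_ground by simp
    then have "E - {e} \<noteq> {}" by (metis card.empty)
    then obtain T where "minimal T" "T \<subseteq> E - {e}"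
      using ex_minimal[of "E - {e}"] nullity_remove(3)[OF e] by (metis Diff_subset order_refl)
    then show "e \<in> (\<Union>T\<in>Collect minimal. E - T)" using e by auto
  qed
  then have "card E = card (\<Union>T\<in>Collect minimal. E - T)"
    by (intro arg_cong[of _ _ card]) auto
  \<comment> \<open>That two minimal sets have union \<open>E\<close> says that their complements
    are disjoint.\<close>
  also have "\<dots> = (\<Sum>T\<in>Collect minimal. card (E - T))"
    using minimal_cover finite_minimal finite_ground by (intro card_UN_disjoint) auto
  finally show ?thesis ..
qed

lemma card_complement: "minimal T \<Longrightarrow> card (E - T) = Suc (2 * (mrank indep E - \<nu> T))"
  using minimal_proper[of T] by (intro core_nullity) (auto simp: cores_def)

text \<open>The odd number \<open>card E\<close> is a sum of odd numbers, one for each minimal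
  set.\<close>

lemma odd_card_minimal: "odd (card (Collect minimal))"
proof -
  have "{T \<in> Collect minimal. odd (card (E - T))} = Collect minimal"
    using card_complement by auto
  then have "even (card E) \<longleftrightarrow> even (card (Collect minimal))"
    using even_sum_iff[OF finite_minimal, of "\<lambda>T. card (E - T)"] sum_card_complements by simp
  then show ?thesis using card_ground by simp
qed

text \<open>Counting \<open>E\<close> by complements gives \<open>2 * r + 1 = 2 * s + p\<close>,
  where \<open>r\<close> is the rank and \<open>p\<close> the number of minimal sets, while the
  signed sum is \<open>r - s\<close>. The doubled form avoids dividing by 2 in an arbitrary
  field.\<close>

lemma sum_core_sign_nullity:
  "2 * (\<Sum>T\<in>cores E indep E. core_sign T * of_nat (mrank indep E - \<nu> T))
    = (of_nat (card (Collect minimal)) - 1 :: 'k::field)"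
proof -
  define s where "s = (\<Sum>T\<in>Collect minimal. mrank indep E - \<nu> T)"
  have "(\<Sum>T\<in>Collect minimal. card (E - T)) = (\<Sum>T\<in>Collect minimal. 2 * (mrank indep E - \<nu> T) + 1)"
    using card_complement by (intro sum.cong) auto
  then have "2 * mrank indep E + 1 = 2 * s + card (Collect minimal)"
    unfolding sum_card_complements card_ground s_def sum_distrib_left sum.distrib by simp
  then have "of_nat (2 * mrank indep E + 1) = (of_nat (2 * s + card (Collect minimal)) :: 'k)"
    by simp
  then have s: "2 * of_nat (mrank indep E) - 2 * of_nat s = (of_nat (card (Collect minimal)) - 1 :: 'k)"
    by (simp add: algebra_simps)
  have eq: "cores E indep E = insert {} (Collect minimal)"
    using minimal_proper unfolding cores_def by blast
  have notin: "{} \<notin> Collect minimal"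
    by (auto simp: minimal_nonempty_crowded_def)
  have "(\<Sum>T\<in>Collect minimal. core_sign T * of_nat (mrank indep E - \<nu> T)) = - (of_nat s :: 'k)"
    unfolding s_def of_nat_sum sum_negf[symmetric]
    using notin by (intro sum.cong) (auto simp: core_sign_def)
  then have "(\<Sum>T\<in>cores E indep E. core_sign T * of_nat (mrank indep E - \<nu> T))
      = of_nat (mrank indep E) - (of_nat s :: 'k)"
    unfolding eq using finite_minimal notin by (simp add: core_sign_def)
  then show ?thesis using s by (simp add: right_diff_distrib)
qed

text \<open>The only crowded subsets of a minimal \<open>S\<close> are \<open>{}\<close> and
  \<open>S\<close>, both summands. Conversely, a nonempty record \<open>S\<close> of crowding 0
  contains a minimal \<open>T\<close> as a summand; then \<open>S - T\<close> also has crowding 0,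
  and it must be empty.\<close>

lemma crowding_records:
  "{S. crowding_record E indep S \<and> crowd indep S = 0} = insert {} (Collect minimal)"
proof (intro set_eqI iffI)
  fix S assume "S \<in> insert {} (Collect minimal)"
  then have S: "S = {} \<or> minimal S" by simp
  have proper: "S \<subset> E"
    using S minimal_proper[of S] card_ground by (elim disjE) auto
  have crowd: "crowd indep S = 0"
    using S crowd_minimal[of S] by (elim disjE) (simp_all add: crowd_def)
  have "\<not> overcrowded_in indep T S" if T: "T \<subseteq> S" for T
  proof -
    have le: "crowd indep T \<le> 0"
      using T proper by (intro crowd_proper) auto
    have "T = {} \<or> T = S" if "crowd indep T = 0"
    proof -
      have "crowded indep T" using that by (simp add: crowded_def)
      then show ?thesis using S T unfolding minimal_nonempty_crowded_def by blast
    qed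
    then have "summand indep T S" if "crowd indep T = 0"
      using T that by (auto simp: summand_def)
    then show ?thesis using le crowd by (auto simp: overcrowded_in_def)
  qed
  then show "S \<in> {S. crowding_record E indep S \<and> crowd indep S = 0}"
    using proper crowd by (auto simp: crowding_record_def)
next
  fix S assume "S \<in> {S. crowding_record E indep S \<and> crowd indep S = 0}"
  then have S: "S \<subseteq> E" "crowd indep S = 0" "\<And>T. T \<subseteq> S \<Longrightarrow> \<not> overcrowded_in indep T S"
    by (auto simp: crowding_record_def)
  have "crowd indep E \<noteq> 0"
    using card_ground by (simp add: crowd_def)
  then have proper: "S \<noteq> E" using S(2) by auto
  show "S \<in> insert {} (Collect minimal)"
  proof (cases "S = {}")
    case False
    obtain T where T: "minimal T" "T \<subseteq> S"
      by (rule ex_minimal[OF S(1) False]) (use S(2) in auto)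
    have "summand indep T S"
      using S(3)[OF T(2)] T(2) S(2) crowd_minimal[OF T(1)] by (auto simp: overcrowded_in_def)
    moreover have "card (S - T) + card T = card S"
      using T(2) finite_sub[OF S(1)] by (metis card_Diff_subset card_mono finite_subset le_add_diff_inverse2)
    ultimately have "crowd indep (S - T) = 0"
      using S(2) crowd_minimal[OF T(1)] unfolding crowd_def summand_def by linarith
    \<comment> \<open>A minimal set inside \<open>S - T\<close> would differ from \<open>T\<close>,
      yet their union lies in \<open>S\<close> and is not all of \<open>E\<close>.\<close>
    moreover have "\<not> minimal T'" if "T' \<subseteq> S - T" for T'
    proof
      assume T': "minimal T'"
      then have "T' \<noteq> T" using that by (auto simp: minimal_nonempty_crowded_def)
      then show False using minimal_cover[OF T(1) T'] that T(2) S(1) proper by auto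
    qed
    ultimately have "S - T = {}"
      using ex_minimal[of "S - T"] S(1) by (metis Diff_subset order_refl order_trans)
    then show ?thesis using T by auto
  qed simp
qed

end


section \<open>The top coefficient of the g-polynomial\<close>

lemma esym_0: "finite A \<Longrightarrow> esym 0 A v = 1"
proof -
  assume "finite A"
  then have "{X. X \<subseteq> A \<and> card X = 0} = {{}}"
    by (auto dest: finite_subset)
  then show ?thesis unfolding esym_def by simp
qed

lemma esym_card: "finite A \<Longrightarrow> esym (card A) A v = (\<Prod>a\<in>A. v a)"
proof -
  assume "finite A"
  then have "{X. X \<subseteq> A \<and> card X = card A} = {A}"
    using card_subset_eq by blast
  then show ?thesis unfolding esym_def by simp
qed

lemma esym_pred_card:
  assumes "finite A" "card A = Suc k"
  shows "esym k A v = (\<Sum>d\<in>A. \<Prod>a\<in>A - {d}. v a)"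
proof -
  have "{X. X \<subseteq> A \<and> card X = k} = (\<lambda>d. A - {d}) ` A"
  proof (intro set_eqI iffI)
    fix X assume "X \<in> {X. X \<subseteq> A \<and> card X = k}"
    then have X: "X \<subseteq> A" "card X = k" by auto
    then have "card (A - X) = 1"
      using assms by (simp add: card_Diff_subset finite_subset)
    then obtain d where "A - X = {d}" by (auto simp: card_1_singleton_iff)
    then have "d \<in> A" "X = A - {d}" using X(1) by auto
    then show "X \<in> (\<lambda>d. A - {d}) ` A" by blast
  qed (use assms in auto)
  moreover have "inj_on (\<lambda>d. A - {d}) A" by (auto simp: inj_on_def)
  ultimately show ?thesis by (simp add: esym_def sum.reindex)
qed

lemma esym_insert:
  assumes "finite A" "x \<notin> A"
  shows "esym (Suc k) (insert x A) v = esym (Suc k) A v + v x * esym k A v"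
proof -
  have "{X. X \<subseteq> insert x A \<and> card X = Suc k}
      = {X. X \<subseteq> A \<and> card X = Suc k} \<union> insert x ` {X. X \<subseteq> A \<and> card X = k}" (is "?L = ?R")
  proof (intro set_eqI iffI)
    fix X assume X: "X \<in> ?L"
    show "X \<in> ?R"
    proof (cases "x \<in> X")
      case True
      then have "X = insert x (X - {x})" "X - {x} \<subseteq> A" "card (X - {x}) = k"
        using X assms by (auto simp: finite_subset card_Diff_singleton)
      then show ?thesis by blast
    qed (use X in auto)
  qed (use assms in \<open>auto simp: card_insert_if finite_subset\<close>)
  moreover have "inj_on (insert x) {X. X \<subseteq> A \<and> card X = k}"
    using assms(2) by (intro inj_onI) (metis (no_types, lifting) insert_ident mem_Collect_eq subsetD)
  moreover have "(\<Prod>a\<in>insert x X. v a) = v x * (\<Prod>a\<in>X. v a)" if "X \<subseteq> A" for X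
    using that assms by (auto simp: finite_subset intro: prod.insert)
  moreover have "{X. X \<subseteq> A \<and> card X = Suc k} \<inter> insert x ` {X. X \<subseteq> A \<and> card X = k} = {}"
    using assms(2) by blast
  ultimately show ?thesis
    using assms(1) unfolding esym_def
    by (simp add: sum.union_disjoint sum.reindex sum_distrib_left)
qed

text \<open>Dividing the generating function of the elementary symmetric polynomials of
  \<open>insert x A\<close> by \<open>1 + v x * t\<close> gives that of \<open>A\<close>; the powers
  of \<open>- v x\<close> come from the geometric series.\<close>

lemma sum_esym_insert:
  assumes "finite A" "x \<notin> A"
  shows "(\<Sum>j\<le>k. (- v x) ^ j * esym (k - j) (insert x A) v) = esym k A v"
proof (induction k)
  case 0
  then show ?case using assms by (simp add: esym_0)
next
  case (Suc k)
  have "(\<Sum>j\<le>Suc k. (- v x) ^ j * esym (Suc k - j) (insert x A) v)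
      = esym (Suc k) (insert x A) v + (- v x) * (\<Sum>j\<le>k. (- v x) ^ j * esym (k - j) (insert x A) v)"
    unfolding sum.atMost_Suc_shift sum_distrib_left by (simp add: mult.assoc)
  then show ?case
    unfolding Suc esym_insert[OF assms] by simp
qed

lemma coeff_minus_X_power:
  "coeff ((- [:0, 1 :: 'k::comm_ring_1:]) ^ i) k = (if k = i then (-1) ^ i else 0)"
proof -
  have "(- [:0, 1 :: 'k:]) ^ i = smult ((-1) ^ i) (monom 1 i)"
    by (simp add: monom_altdef) (metis minus_pCons minus_zero power_minus smult_1_left smult_minus_left smult_power)
  then show ?thesis by simp
qed

text \<open>Ensures that the interpolation nodes are distinct.\<close>

lemma inj_Var: "inj_on Var A"
proof (rule inj_onI)
  fix a b :: 'a
  assume "Var a = Var b"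
  then have "Poly_Mapping.single (Poly_Mapping.single (Indet a) (1 :: nat)) (1 :: int)
      = Poly_Mapping.single (Poly_Mapping.single (Indet b) 1) 1"
    by (simp add: Var_def eq_fract)
  then have "Poly_Mapping.keys (Poly_Mapping.single (Poly_Mapping.single (Indet a) (1 :: nat)) (1 :: int))
      = Poly_Mapping.keys (Poly_Mapping.single (Poly_Mapping.single (Indet b) (1 :: nat)) (1 :: int))"
    by simp
  then have "Poly_Mapping.keys (Poly_Mapping.single (Indet a) (1 :: nat))
      = Poly_Mapping.keys (Poly_Mapping.single (Indet b) (1 :: nat))"
    by simp
  then show "a = b" by simp
qed

section \<open>Reduction of the top coefficient to a sum over words\<close>

context almost_balanced_matroid
begin

text \<open>A coloop would lower the rank when deleted, and a loop would be a proper subset of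
  crowding 1. Hence the zero clause in the definition of \<open>speyer_g\<close> does not
  apply.\<close>

lemma no_loop_coloop: "\<not> loop E indep e" "\<not> coloop E indep e"
proof -
  show "\<not> coloop E indep e"
    using coloop_mrank[of e] nullity_remove(2)[of e] by (auto simp: coloop_def)
  show "\<not> loop E indep e"
  proof
    assume e: "loop E indep e"
    then have "e \<in> E" by (simp add: loop_def)
    moreover have "card {e} < card E" using card_ground mrank_pos by simp
    ultimately have "crowd indep {e} \<le> 0" by (intro crowd_proper) auto
    then show False using loop_mrank[OF e] by (simp add: crowd_def)
  qed
qed

text \<open>The nonbasis \<open>N\<close> of the whole word is \<open>insert x A\<close>, with
  \<open>A\<close> the nonbasis of \<open>u\<close>. The powers of \<open>- z x\<close> remove
  \<open>x\<close> from the symmetric polynomials by \<open>sum_esym_insert\<close>, leaving degree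
  \<open>r - 1\<close> in the \<open>r\<close> variables of \<open>A\<close>; times the full product
  over \<open>A\<close> this is \<open>der_weight\<close>.\<close>

lemma numerator_snoc:
  fixes z :: "'a \<Rightarrow> 'k::field"
  assumes x: "x \<in> E" and u: "u \<in> permutations_of_set (E - {x})"
  defines "r \<equiv> mrank indep E" and "N \<equiv> E - ord_basis indep (u @ [x])"
  shows "(\<Sum>j = 0..r - 1. (- z x) ^ j * esym (r - j - 1) N z * esym (Suc r) N (\<lambda>c. - z c))
    = (-1) ^ Suc r * (z x * der_weight indep z u)"
proof -
  have u': "set u = E - {x}" "distinct u"
    using u by (auto simp: permutations_of_set_def)
  define A where "A = nonbasis indep u"
  have A: "finite A" "x \<notin> A" "card A = r"
    using u' card_nonbasis[of u] nullity_remove(1)[OF x] finite_ground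
    by (auto simp: A_def nonbasis_def r_def)
  have N: "N = insert x A"
    using nonbasis_snoc[of x u] x u' nullity_remove(2)[OF x]
    by (auto simp: A_def N_def nonbasis_def insert_absorb)
  obtain k where k: "r = Suc k" using mrank_pos by (cases r) (auto simp: r_def)
  have "card N = Suc r" using A N by simp
  \<comment> \<open>The degree equals the number of variables, so only the full product
    survives.\<close>
  then have top: "esym (Suc r) N (\<lambda>c. - z c) = (-1) ^ Suc r * (\<Prod>c\<in>N. z c)"
    using esym_card[of N "\<lambda>c. - z c"] A N by (simp add: prod_uminus)
  have "(\<Sum>j = 0..r - 1. (- z x) ^ j * esym (r - j - 1) N z * esym (Suc r) N (\<lambda>c. - z c))
      = (\<Sum>j\<le>k. (- z x) ^ j * esym (k - j) N z) * esym (Suc r) N (\<lambda>c. - z c)"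
    unfolding k sum_distrib_right atLeast0AtMost by simp
  also have "\<dots> = esym k A z * ((-1) ^ Suc r * (\<Prod>c\<in>N. z c))"
    unfolding N sum_esym_insert[OF A(1,2)] top[unfolded N] ..
  also have "\<dots> = (-1) ^ Suc r * (z x * ((\<Prod>c\<in>A. z c) * esym k A z))"
    using A N by simp
  also have "(\<Prod>c\<in>A. z c) * esym k A z = der_weight indep z u"
    unfolding esym_pred_card[OF A(1) A(3)[unfolded k]] der_weight_def A_def[symmetric] sum_distrib_left
  proof (rule sum.cong[OF refl])
    fix d assume "d \<in> A"
    then show "(\<Prod>c\<in>A. z c) * (\<Prod>a\<in>A - {d}. z a) = z d * (\<Prod>c\<in>A - {d}. (z c)\<^sup>2)"
      using A(1) by (simp add: prod.remove[of A d] power2_eq_square prod.distrib)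
  qed
  finally show ?thesis .
qed

lemma omega_eq_word_sum:
  assumes "connected_matroid E indep"
  shows "omega E indep = (\<Sum>x\<in>E. Var x * word_sum Var (der_weight indep Var) (E - {x}) x)"
proof -
  define r where "r = mrank indep E"
  define F where "F i j w = (- Var (last w)) ^ j * esym (i - j - 1) (E - ord_basis indep w) (\<lambda>c. - (- Var c))
    * esym (r - i) (ord_basis indep w) Var * esym (card E - r) (E - ord_basis indep w) (\<lambda>c. - Var c)" for i j w
  have E: "E \<noteq> {}" using card_ground by auto
  have r: "r \<ge> 1" "card E - r = Suc r" using mrank_pos card_ground by (auto simp: r_def)
  have comp: "num_components E indep = 1"
    using assms by (simp add: connected_matroid_def)
  have "speyer_g E indep =
      - (\<Sum>i = 1..r. (- [:0, 1:]) ^ i * (\<Sum>j = 0..i - 1. [:deg E (F i j):]))"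
    unfolding speyer_g_def Let_def F_def r_def using E no_loop_coloop comp by simp
  then have "omega E indep = - (\<Sum>i = 1..r. \<Sum>j = 0..i - 1. coeff ((- [:0, 1:]) ^ i * [:deg E (F i j):]) r)"
    unfolding omega_def r_def[symmetric] by (simp add: coeff_sum sum_distrib_left)
  \<comment> \<open>Only the summand \<open>i = r\<close> contributes to the coefficient of degree
    \<open>r\<close>.\<close>
  also have "(\<Sum>i = 1..r. \<Sum>j = 0..i - 1. coeff ((- [:0, 1:]) ^ i * [:deg E (F i j):]) r)
      = (\<Sum>i = 1..r. if i = r then \<Sum>j = 0..r - 1. deg E (F r j) * (-1) ^ r else 0)"
    by (intro sum.cong refl) (auto simp: mult.commute[of _ "[:_:]"] coeff_minus_X_power simp del: minus_pCons)
  also have "\<dots> = (-1) ^ r * (\<Sum>j = 0..r - 1. deg E (F r j))"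
    using r(1) by (simp add: sum_distrib_left mult.commute)
  also have "(\<Sum>j = 0..r - 1. deg E (F r j))
      = (\<Sum>w\<in>permutations_of_set E. (\<Sum>j = 0..r - 1. F r j w) / path_prod Var w)"
    unfolding deg_def sum_divide_distrib
    by (subst sum.swap) (auto intro!: sum.cong simp: path_prod_def permutations_of_set_def distinct_card[symmetric])
  also have "\<dots> = (\<Sum>x\<in>E. \<Sum>u\<in>permutations_of_set (E - {x}).
      (-1) ^ Suc r * (Var x * (der_weight indep Var u / path_prod Var (u @ [x]))))"
    unfolding sum_permutations_snoc[OF finite_ground E]
  proof (intro sum.cong refl)
    fix x u assume x: "x \<in> E" "u \<in> permutations_of_set (E - {x})"
    \<comment> \<open>For \<open>i = r\<close> the factor in the basis letters is
      \<open>esym 0\<close>, which is 1 on a finite set.\<close>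
    have "finite (ord_basis indep (u @ [x]))"
      by (rule finite_subset[OF ord_basis_subset]) simp
    then have "(\<Sum>j = 0..r - 1. F r j (u @ [x])) = (-1) ^ Suc r * (Var x * der_weight indep Var u)"
      unfolding numerator_snoc[OF x, of Var, folded r_def, symmetric] F_def r(2)
      by (simp add: esym_0)
    then show "(\<Sum>j = 0..r - 1. F r j (u @ [x])) / path_prod Var (u @ [x])
        = (-1) ^ Suc r * (Var x * (der_weight indep Var u / path_prod Var (u @ [x])))"
      by (simp only: times_divide_eq_right)
  qed
  also have "\<dots> = (-1) ^ Suc r * (\<Sum>x\<in>E. Var x * word_sum Var (der_weight indep Var) (E - {x}) x)"
    by (simp add: word_sum_def sum_distrib_left)
  \<comment> \<open>Three signs cancel: one from the single component, one from the power of
    \<open>- t\<close>, one from the \<open>Suc r\<close> negated variables.\<close>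
  also have "- ((-1) ^ r * ((-1) ^ Suc r * (\<Sum>x\<in>E. Var x * word_sum Var (der_weight indep Var) (E - {x}) x)))
      = (\<Sum>x\<in>E. Var x * word_sum Var (der_weight indep Var) (E - {x}) x)"
    by (simp flip: mult.assoc power_add mult_2)
  finally show ?thesis .
qed

lemma omega_eq:
  assumes "connected_matroid E indep"
  shows "omega E indep = (of_nat (card (Collect minimal)) - 1) / 2"
proof -
  \<comment> \<open>Halving is legitimate because the integers embed into the rational
    functions.\<close>
  have "(2 :: 'a ratfun) \<noteq> 0"
    using injD[OF inj_of_int_ratfun, of 2 0] by auto
  moreover have "2 * omega E indep = of_nat (card (Collect minimal)) - 1"
    unfolding omega_eq_word_sum[OF assms] sum_word_sum_der_weight[OF inj_Var]
    by (rule sum_core_sign_nullity)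
  ultimately show ?thesis by (simp add: field_simps)
qed

end

theorem proposition12p7:
  fixes E :: "'a set" and indep :: "'a set \<Rightarrow> bool"
    and r p :: nat and T :: "nat \<Rightarrow> 'a set"
  assumes "matroid E indep"
    and "connected_matroid E indep"
    and "mrank indep E = r"
    and "r > 0"
    and "card E = 2 * r + 1"
    and "\<forall>S. S \<subset> E \<longrightarrow> crowd indep S \<le> 0"
    and "bij_betw T {1..p} {S. minimal_nonempty_crowded E indep S}"
    and "\<forall>i\<in>{1..p}. \<forall>j\<in>{1..p}. i \<noteq> j \<longrightarrow> T i \<union> T j = E"
  shows "{S. crowding_record E indep S \<and> crowd indep S = 0} = insert {} (T ` {1..p})
    \<and> odd p
    \<and> omega E indep = (of_nat p - 1) / 2"
proof -
  have T: "T ` {1..p} = {S. minimal_nonempty_crowded E indep S}"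
    using assms(7) by (rule bij_betw_imp_surj_on)
  have p: "card {S. minimal_nonempty_crowded E indep S} = p"
    using bij_betw_same_card[OF assms(7)] by simp
  \<comment> \<open>Every minimal set is some \<open>T i\<close>, and different sets have different
    indices, so the indexed hypothesis yields the one on pairs of sets.\<close>
  have cover: "X \<union> Y = E"
    if XY: "minimal_nonempty_crowded E indep X" "minimal_nonempty_crowded E indep Y" "X \<noteq> Y" for X Y
  proof -
    have "X \<in> T ` {1..p}" "Y \<in> T ` {1..p}"
      unfolding T using XY(1,2) by simp_all
    then obtain i j where ij: "i \<in> {1..p}" "j \<in> {1..p}" and eq: "X = T i" "Y = T j"
      by (elim imageE)
    have "i \<noteq> j" using XY(3) eq by metis
    then show ?thesis unfolding eq by (rule assms(8)[rule_format, OF ij])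
  qed
  interpret almost_balanced_matroid E indep
  proof (intro almost_balanced_matroid.intro almost_balanced_matroid_axioms.intro)
    show "matroid E indep" by (fact assms(1))
    show "0 < mrank indep E" "card E = 2 * mrank indep E + 1"
      using assms(3-5) by simp_all
  qed (use assms(6) in blast, fact cover)
  show ?thesis
    using crowding_records odd_card_minimal omega_eq[OF assms(2)] unfolding T p by (intro conjI)
qed

end
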